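(* For an integer $n\geq 1$ define $A_n=\{k^2 : k=1,2,\ldots,n\}$, and let $a_n$ denote the median absolute deviation of $A_n$, i.e., \[a_n=\operatorname{median}\left(\{|x-\operatorname{median}(A_n)| : x\in A_n\}\right).\] Then $\lim_{n\to\infty} a_n/n^2=\sqrt{3}/8$.
   Context: The median of a finite collection of real numbers is the middle element when the collection is sorted in increasing order if the number of elements is odd, and the arithmetic mean of the two middle elements if the number of elements is even. *)

theory Defs
  imports Complex_Main "HOL-Library.Multiset"
begin

text \<open>
  A collection of reals is a multiset, so repeated values count with multiplicity.
  The value at the empty multiset is junk.
\<close>

definition median :: "real multiset \<Rightarrow> real" where
  "median M =
     (let xs = sorted_list_of_multiset M; n = size M in
      if odd n then xs ! (n div 2)
      else (xs ! (n div 2 - 1) + xs ! (n div 2)) / 2)"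

text \<open>
  The deviations are kept with multiplicity: distinct points of \<open>M\<close> on opposite sides
  of the median may have the same absolute deviation.
\<close>

definition median_abs_dev :: "real multiset \<Rightarrow> real" where
  "median_abs_dev M = median {# \<bar>x - median M\<bar>. x \<in># M #}"

definition first_squares :: "nat \<Rightarrow> real set" where
  "first_squares n = {(real k)\<^sup>2 | k. k \<in> {1..n}}"

end

theory Submission
  imports Defs
begin

text \<open>
  A number \<open>t\<close> bounds the median from above (below) as soon as more than half of the elements
  lie below (above) it, so only counting is needed. The median of \<open>A\<^sub>n\<close> is \<open>n\<^sup>2/4 + O(n)\<close>.
  Hence the deviation of \<open>k\<^sup>2\<close> is at most about \<open>r n\<^sup>2\<close> iff \<open>k/n\<close> lies between
  \<open>sqrt (1/4 - r)\<close> and \<open>sqrt (1/4 + r)\<close>. The length of this interval is strictly increasing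
  in \<open>r\<close>, and it equals \<open>1/2\<close> exactly at \<open>r = sqrt 3 / 8\<close>.
\<close>

section \<open>Bounding the median by counting\<close>

text \<open>For odd size the two rounded indices coincide at the middle entry, so one formula serves
  both parities and later arguments need no case split.\<close>

lemma median_alt:
  "median M = (sorted_list_of_multiset M ! ((size M - 1) div 2)
             + sorted_list_of_multiset M ! (size M div 2)) / 2"
proof (cases "odd (size M)")
  case True
  then have "(size M - 1) div 2 = size M div 2"
    by presburger
  with True show ?thesis
    by (simp add: median_def Let_def)
next
  case False
  then have "(size M - 1) div 2 = size M div 2 - 1"
    by presburger
  with False show ?thesis
    by (simp add: median_def Let_def)
qed

lemma length_sorted_list_of_multiset [simp]: "length (sorted_list_of_multiset M) = size M"
  by (metis mset_sorted_list_of_multiset size_mset)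

lemma size_filter_mset_sorted:
  "size (filter_mset P M) = card {i. i < size M \<and> P (sorted_list_of_multiset M ! i)}"
proof -
  have "size (filter_mset P M) = length (filter P (sorted_list_of_multiset M))"
    by (metis mset_filter mset_sorted_list_of_multiset size_mset)
  then show ?thesis
    by (simp add: length_filter_conv_card)
qed

text \<open>It is enough to bound the upper middle entry. If it exceeded \<open>t\<close>,
  sortedness would leave at most the \<open>n div 2\<close> entries before it below
  \<open>t\<close>, which is not a majority.\<close>

lemma median_le:
  assumes "size M < 2 * size (filter_mset (\<lambda>x. x \<le> t) M)"
  shows "median M \<le> t"
proof -
  define xs n where "xs = sorted_list_of_multiset M" and "n = size M"
  have mono: "xs ! i \<le> xs ! j" if "i \<le> j" "j < n" for i j
    using that by (simp add: xs_def n_def sorted_nth_mono)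
  have "size (filter_mset (\<lambda>x. x \<le> t) M) \<le> n"
    unfolding n_def by (rule size_filter_mset_lesseq)
  with assms have "n > 0"
    unfolding n_def by linarith
  have "xs ! (n div 2) \<le> t"
  proof (rule ccontr)
    assume *: "\<not> xs ! (n div 2) \<le> t"
    have "{i. i < n \<and> xs ! i \<le> t} \<subseteq> {..<n div 2}"
      using * mono by (force simp: not_le)
    then have "card {i. i < n \<and> xs ! i \<le> t} \<le> n div 2"
      using card_mono[of "{..<n div 2}"] by simp
    with assms show False
      unfolding size_filter_mset_sorted xs_def n_def by linarith
  qed
  moreover have "xs ! ((n - 1) div 2) \<le> xs ! (n div 2)"
    using \<open>n > 0\<close> by (intro mono) (auto intro: div_le_mono)
  ultimately show ?thesis
    by (simp add: median_alt xs_def n_def)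
qed

text \<open>Dual argument at the lower middle entry: if it were below \<open>t\<close>, only the
  \<open>n div 2\<close> entries after it could reach \<open>t\<close>.\<close>

lemma median_ge:
  assumes "size M < 2 * size (filter_mset (\<lambda>x. t \<le> x) M)"
  shows "t \<le> median M"
proof -
  define xs n where "xs = sorted_list_of_multiset M" and "n = size M"
  have mono: "xs ! i \<le> xs ! j" if "i \<le> j" "j < n" for i j
    using that by (simp add: xs_def n_def sorted_nth_mono)
  have "size (filter_mset (\<lambda>x. t \<le> x) M) \<le> n"
    unfolding n_def by (rule size_filter_mset_lesseq)
  with assms have "n > 0"
    unfolding n_def by linarith
  have "t \<le> xs ! ((n - 1) div 2)"
  proof (rule ccontr)
    assume *: "\<not> t \<le> xs ! ((n - 1) div 2)"
    have "i > (n - 1) div 2" if "i < n" "t \<le> xs ! i" for i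
    proof (rule ccontr)
      assume "\<not> i > (n - 1) div 2"
      then have "xs ! i \<le> xs ! ((n - 1) div 2)"
        using \<open>n > 0\<close> by (intro mono) auto
      with that * show False
        by simp
    qed
    then have "{i. i < n \<and> t \<le> xs ! i} \<subseteq> {(n - 1) div 2<..<n}"
      by auto
    then have "card {i. i < n \<and> t \<le> xs ! i} \<le> n - Suc ((n - 1) div 2)"
      using card_mono[of "{(n - 1) div 2<..<n}"] by simp
    with assms \<open>n > 0\<close> show False
      unfolding size_filter_mset_sorted xs_def[symmetric] n_def[symmetric] by linarith
  qed
  moreover have "xs ! ((n - 1) div 2) \<le> xs ! (n div 2)"
    using \<open>n > 0\<close> by (intro mono) (auto intro: div_le_mono)
  ultimately show ?thesis
    by (simp add: median_alt xs_def n_def)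
qed

text \<open>A majority set \<open>B\<close> of indices serves as witness, so the exact number of
  small values is never computed.\<close>

lemma median_image_le:
  assumes "finite A" "B \<subseteq> A" "\<And>a. a \<in> B \<Longrightarrow> f a \<le> t" "card A < 2 * card B"
  shows "median (image_mset f (mset_set A)) \<le> t"
proof (rule median_le)
  have "card B \<le> card {a \<in> A. f a \<le> t}"
    using assms by (intro card_mono) auto
  with assms show "size (image_mset f (mset_set A))
      < 2 * size (filter_mset (\<lambda>x. x \<le> t) (image_mset f (mset_set A)))"
    by (simp add: filter_mset_image_mset)
qed

lemma median_image_ge:
  assumes "finite A" "B \<subseteq> A" "\<And>a. a \<in> B \<Longrightarrow> t \<le> f a" "card A < 2 * card B"
  shows "t \<le> median (image_mset f (mset_set A))"
proof (rule median_ge)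
  have "card B \<le> card {a \<in> A. t \<le> f a}"
    using assms by (intro card_mono) auto
  with assms show "size (image_mset f (mset_set A))
      < 2 * size (filter_mset (\<lambda>x. t \<le> x) (image_mset f (mset_set A)))"
    by (simp add: filter_mset_image_mset)
qed

section \<open>The median of the first squares\<close>

lemma mset_set_first_squares:
  "mset_set (first_squares n) = image_mset (\<lambda>k. (real k)\<^sup>2) (mset_set {1..n})"
proof -
  \<comment> \<open>Distinct indices give distinct squares, so no multiplicity is lost and all
    counting can be done over \<open>k\<close>.\<close>
  have "inj_on (\<lambda>k. (real k)\<^sup>2) {1..n}"
    by (auto simp: inj_on_def)
  moreover have "first_squares n = (\<lambda>k. (real k)\<^sup>2) ` {1..n}"
    by (auto simp: first_squares_def)
  ultimately show ?thesis
    by (simp add: image_mset_mset_set)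
qed

lemma median_first_squares_le:
  assumes "n > 1"
  shows "median (mset_set (first_squares n)) \<le> (real n / 2 + 1)\<^sup>2"
  unfolding mset_set_first_squares
proof (rule median_image_le)
  show "{1..n div 2 + 1} \<subseteq> {1..n}"
    using assms by auto
  show "(real k)\<^sup>2 \<le> (real n / 2 + 1)\<^sup>2" if "k \<in> {1..n div 2 + 1}" for k
    using that by (intro power_mono) auto
qed auto

lemma median_first_squares_ge:
  assumes "n > 0"
  shows "(real n / 2)\<^sup>2 \<le> median (mset_set (first_squares n))"
  unfolding mset_set_first_squares
proof (rule median_image_ge)
  \<comment> \<open>Rounding up makes the least index at least \<open>n / 2\<close>, and still
    leaves \<open>n div 2 + 1\<close> indices, a strict majority.\<close>
  show "{(n + 1) div 2..n} \<subseteq> {1..n}"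
    using assms by auto
  show "(real n / 2)\<^sup>2 \<le> (real k)\<^sup>2" if "k \<in> {(n + 1) div 2..n}" for k
    using that by (intro power_mono) auto
  show "card {1..n} < 2 * card {(n + 1) div 2..n}"
    using assms by simp
qed auto

lemma median_first_squares_tendsto:
  "(\<lambda>n. median (mset_set (first_squares n)) / (real n)\<^sup>2) \<longlonglongrightarrow> 1 / 4"
proof (rule tendsto_sandwich)
  show "\<forall>\<^sub>F n in sequentially. 1 / 4 \<le> median (mset_set (first_squares n)) / (real n)\<^sup>2"
    using eventually_gt_at_top[of 0]
  proof eventually_elim
    case (elim n)
    then show ?case
      using median_first_squares_ge[of n] by (simp add: field_simps power2_eq_square)
  qed
  show "\<forall>\<^sub>F n in sequentially.
      median (mset_set (first_squares n)) / (real n)\<^sup>2 \<le> (1 / 2 + 1 / real n)\<^sup>2"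
    using eventually_gt_at_top[of 1]
  proof eventually_elim
    case (elim n)
    then have "(1 / 2 + 1 / real n)\<^sup>2 = (real n / 2 + 1)\<^sup>2 / (real n)\<^sup>2"
      by (simp add: power_divide[symmetric] add_divide_distrib)
    with elim show ?case
      using median_first_squares_le[of n] by (simp add: divide_right_mono)
  qed
  have "(\<lambda>n. (1 / 2 + 1 / real n)\<^sup>2) \<longlonglongrightarrow> (1 / 2 + 0)\<^sup>2"
    by (intro tendsto_intros lim_1_over_n)
  then show "(\<lambda>n. (1 / 2 + 1 / real n)\<^sup>2) \<longlonglongrightarrow> 1 / 4"
    by (simp add: power2_eq_square)
qed auto

section \<open>Integers between square roots, and the length of the interval\<close>

lemma card_nat_closed_interval_ge:
  assumes "0 \<le> x" "0 \<le> y"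
  shows "y - x - 1 \<le> real (card {k::nat. x \<le> real k \<and> real k \<le> y})"
proof -
  have "{k::nat. x \<le> real k \<and> real k \<le> y} = {nat \<lceil>x\<rceil>..nat \<lfloor>y\<rfloor>}"
    using assms by (auto simp: le_nat_floor nat_le_iff ceiling_le_iff le_nat_iff le_floor_iff)
  then have "card {k::nat. x \<le> real k \<and> real k \<le> y} = Suc (nat \<lfloor>y\<rfloor>) - nat \<lceil>x\<rceil>"
    by simp
  then show ?thesis
    using assms by linarith
qed

lemma card_nat_open_interval_le:
  assumes "0 \<le> x" "x \<le> y"
  shows "real (card {k::nat. x < real k \<and> real k < y}) \<le> y - x + 1"
proof -
  have "{k::nat. x < real k \<and> real k < y} \<subseteq> {nat \<lfloor>x\<rfloor><..<nat \<lceil>y\<rceil>}"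
    using assms by (auto simp: nat_less_iff floor_less_iff zless_nat_eq_int_zless less_ceiling_iff)
  then have "card {k::nat. x < real k \<and> real k < y} \<le> nat \<lceil>y\<rceil> - Suc (nat \<lfloor>x\<rfloor>)"
    using card_mono[of "{nat \<lfloor>x\<rfloor><..<nat \<lceil>y\<rceil>}"] by simp
  then show ?thesis
    using assms by linarith
qed

text \<open>No sign condition on \<open>c\<close> arises: \<open>sqrt\<close> is extended to
  negative reals as an odd function, which is multiplicative and strictly increasing on the whole
  line.\<close>

lemma sqrt_mult_le_iff:
  assumes "0 \<le> x" "0 \<le> y"
  shows "sqrt c * y \<le> x \<longleftrightarrow> c * y\<^sup>2 \<le> x\<^sup>2" and "x \<le> sqrt c * y \<longleftrightarrow> x\<^sup>2 \<le> c * y\<^sup>2"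
proof -
  have "sqrt (c * y\<^sup>2) = sqrt c * y" "sqrt (x\<^sup>2) = x"
    using assms by (simp_all add: real_sqrt_mult)
  then show "sqrt c * y \<le> x \<longleftrightarrow> c * y\<^sup>2 \<le> x\<^sup>2" "x \<le> sqrt c * y \<longleftrightarrow> x\<^sup>2 \<le> c * y\<^sup>2"
    by (metis real_sqrt_le_iff)+
qed

text \<open>For \<open>0 \<le> r \<le> 1/4\<close> this is the limiting proportion of
  \<open>k\<close> in \<open>{1..n}\<close> whose square is within \<open>r * n^2\<close> of
  \<open>n^2 / 4\<close>.\<close>

definition gap :: "real \<Rightarrow> real" where
  "gap r = sqrt (1 / 4 + r) - sqrt (1 / 4 - r)"

lemma gap_strict_mono: "r < s \<Longrightarrow> gap r < gap s"
  by (simp add: gap_def diff_strict_mono)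

lemma gap_sqrt3: "gap (sqrt 3 / 8) = 1 / 2"
proof -
  \<comment> \<open>Both radicands are perfect squares, so the nested roots simplify and differ by
    \<open>2 / 4\<close>.\<close>
  have "1 / 4 + sqrt 3 / 8 = ((sqrt 3 + 1) / 4)\<^sup>2" "1 / 4 - sqrt 3 / 8 = ((sqrt 3 - 1) / 4)\<^sup>2"
    by (simp_all add: power2_eq_square field_simps)
  then show ?thesis
    by (simp add: gap_def diff_divide_distrib[symmetric])
qed

section \<open>Bounds on the deviation for a fixed \<open>n\<close>\<close>

lemma median_abs_dev_first_squares:
  "median_abs_dev (mset_set (first_squares n)) =
     median (image_mset (\<lambda>k. \<bar>(real k)\<^sup>2 - median (mset_set (first_squares n))\<bar>) (mset_set {1..n}))"
  unfolding median_abs_dev_def mset_set_first_squares by (simp add: multiset.map_comp comp_def)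

text \<open>Here \<open>d\<close> absorbs the error of replacing the median by
  \<open>n^2 / 4\<close>, and the last hypothesis says that the interval holds a majority even after
  a rounding loss of 1.\<close>

lemma median_abs_dev_le:
  assumes r: "0 \<le> r" "r < 1 / 4"
    and near: "\<bar>median (mset_set (first_squares n)) - (real n)\<^sup>2 / 4\<bar> \<le> d * (real n)\<^sup>2"
    and n: "n > 0" "real n < 2 * (gap r * real n - 1)"
  shows "median_abs_dev (mset_set (first_squares n)) \<le> (r + d) * (real n)\<^sup>2"
  unfolding median_abs_dev_first_squares
proof (rule median_image_le)
  define B where "B = {k::nat. sqrt (1 / 4 - r) * n \<le> real k \<and> real k \<le> sqrt (1 / 4 + r) * n}"
  have B: "k \<in> B \<longleftrightarrow> \<bar>(real k)\<^sup>2 - (real n)\<^sup>2 / 4\<bar> \<le> r * (real n)\<^sup>2" for k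
    unfolding B_def mem_Collect_eq sqrt_mult_le_iff[OF of_nat_0_le_iff of_nat_0_le_iff]
    by (auto simp: abs_le_iff algebra_simps)
  show "B \<subseteq> {1..n}"
  proof
    fix k assume k: "k \<in> B"
    \<comment> \<open>The strict bound \<open>r < 1/4\<close> is what excludes
      \<open>k = 0\<close>.\<close>
    have "0 < sqrt (1 / 4 - r) * n"
      using r n by simp
    moreover have "sqrt (1 / 4 + r) * n \<le> 1 * real n"
      using r by (intro mult_right_mono) auto
    ultimately have "0 < real k" "real k \<le> real n"
      using k by (auto simp: B_def)
    then show "k \<in> {1..n}"
      by simp
  qed
  show "\<bar>(real k)\<^sup>2 - median (mset_set (first_squares n))\<bar> \<le> (r + d) * (real n)\<^sup>2" if "k \<in> B" for k
    using that near unfolding B by (simp add: distrib_right abs_le_iff)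
  have "gap r * real n - 1 \<le> card B"
    unfolding B_def gap_def left_diff_distrib
    by (rule card_nat_closed_interval_ge) (use r in auto)
  with n show "card {1..n} < 2 * card B"
    by simp
qed auto

text \<open>The majority is now the complement of the interval, which is taken open so that its
  endpoints count as far from the centre.\<close>

lemma median_abs_dev_ge:
  assumes r: "0 \<le> r" "r \<le> 1 / 4"
    and near: "\<bar>median (mset_set (first_squares n)) - (real n)\<^sup>2 / 4\<bar> \<le> d * (real n)\<^sup>2"
    and n: "2 * (gap r * real n + 1) < real n"
  shows "(r - d) * (real n)\<^sup>2 \<le> median_abs_dev (mset_set (first_squares n))"
  unfolding median_abs_dev_first_squares
proof (rule median_image_ge)
  define B where "B = {k::nat. sqrt (1 / 4 - r) * n < real k \<and> real k < sqrt (1 / 4 + r) * n}"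
  have B: "k \<in> B \<longleftrightarrow> \<bar>(real k)\<^sup>2 - (real n)\<^sup>2 / 4\<bar> < r * (real n)\<^sup>2" for k
    unfolding B_def mem_Collect_eq not_le[symmetric]
      sqrt_mult_le_iff[OF of_nat_0_le_iff of_nat_0_le_iff]
    by (auto simp: abs_less_iff algebra_simps)
  show "(r - d) * (real n)\<^sup>2 \<le> \<bar>(real k)\<^sup>2 - median (mset_set (first_squares n))\<bar>"
    if "k \<in> {1..n} - B" for k
  proof -
    have "r * (real n)\<^sup>2 \<le> \<bar>(real k)\<^sup>2 - (real n)\<^sup>2 / 4\<bar>"
      using that B by auto
    with near show ?thesis
      unfolding left_diff_distrib by linarith
  qed
  \<comment> \<open>\<open>B\<close> is not shown to lie inside \<open>{1..n}\<close>; finiteness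
    suffices to bound the complement by subtracting cardinalities.\<close>
  have "finite B"
    by (rule finite_subset[of _ "{..nat \<lceil>sqrt (1 / 4 + r) * n\<rceil>}"])
      (auto simp: B_def, linarith)
  then have "card {1..n} - card B \<le> card ({1..n} - B)"
    by (rule diff_card_le_card_Diff)
  moreover have "card B \<le> gap r * real n + 1"
    unfolding B_def gap_def left_diff_distrib
    by (rule card_nat_open_interval_le) (use r in \<open>auto intro!: mult_right_mono\<close>)
  ultimately show "card {1..n} < 2 * card ({1..n} - B)"
    using n by simp
qed auto

section \<open>Passage to the limit\<close>

lemma eventually_median_first_squares_near:
  assumes "d > 0"
  shows "\<forall>\<^sub>F n in sequentially.
    \<bar>median (mset_set (first_squares n)) - (real n)\<^sup>2 / 4\<bar> \<le> d * (real n)\<^sup>2"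
  using tendstoD[OF median_first_squares_tendsto assms] eventually_gt_at_top[of 0]
proof eventually_elim
  case (elim n)
  then have "\<bar>median (mset_set (first_squares n)) / (real n)\<^sup>2 - 1 / 4\<bar> * (real n)\<^sup>2
      \<le> d * (real n)\<^sup>2"
    by (intro mult_right_mono) (auto simp: dist_real_def)
  moreover have "\<bar>median (mset_set (first_squares n)) / (real n)\<^sup>2 - 1 / 4\<bar> * (real n)\<^sup>2
      = \<bar>(median (mset_set (first_squares n)) / (real n)\<^sup>2 - 1 / 4) * (real n)\<^sup>2\<bar>"
    by (simp add: abs_mult)
  ultimately show ?case
    using elim by (simp add: left_diff_distrib)
qed

lemma eventually_less_linear:
  fixes c C :: real
  assumes "c > 0"
  shows "\<forall>\<^sub>F n in sequentially. C < c * real n"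
  using eventually_gt_at_top[of "nat \<lceil>C / c\<rceil>"]
proof eventually_elim
  case (elim n)
  then have "C / c < real n"
    by linarith
  with assms show ?case
    by (simp add: field_simps)
qed

theorem theorem3:
  "(\<lambda>n::nat. median_abs_dev (mset_set (first_squares n)) / (real n)\<^sup>2) \<longlonglongrightarrow> sqrt 3 / 8"
proof (rule order_tendstoI)
  fix a :: real
  assume "a < sqrt 3 / 8"
  then have "max a 0 < sqrt 3 / 8"
    unfolding max_def by simp
  \<comment> \<open>The maximum with 0 keeps \<open>r\<close> nonnegative when \<open>a\<close> is
    negative, as the lower bound requires; \<open>sqrt 3 < 2\<close> then gives
    \<open>r < 1/4\<close>.\<close>
  then obtain r where r: "max a 0 < r" "r < sqrt 3 / 8"
    using dense by blast
  have "sqrt 3 < 2"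
    by (rule real_less_lsqrt) auto
  \<comment> \<open>Half the slack, so that \<open>r - d\<close> is the midpoint of \<open>a\<close>
    and \<open>r\<close>.\<close>
  define d where "d = (r - a) / 2"
  have "d > 0"
    using r by (simp add: d_def)
  have "gap r < 1 / 2"
    using gap_strict_mono[OF r(2)] gap_sqrt3 by simp
  \<comment> \<open>This is the counting hypothesis of \<open>median_abs_dev_ge\<close>, rearranged:
    a linear surplus eventually beats the rounding error.\<close>
  then have "\<forall>\<^sub>F n in sequentially. 2 < (1 - 2 * gap r) * real n"
    by (intro eventually_less_linear) simp
  with eventually_median_first_squares_near[OF \<open>d > 0\<close>] eventually_gt_at_top[of 0]
  show "\<forall>\<^sub>F n in sequentially. a < median_abs_dev (mset_set (first_squares n)) / (real n)\<^sup>2"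
  proof eventually_elim
    case (elim n)
    have "(r - d) * (real n)\<^sup>2 \<le> median_abs_dev (mset_set (first_squares n))"
      using elim r \<open>sqrt 3 < 2\<close> by (intro median_abs_dev_ge) (auto simp: algebra_simps)
    then have "r - d \<le> median_abs_dev (mset_set (first_squares n)) / (real n)\<^sup>2"
      using elim by (simp add: pos_le_divide_eq)
    moreover have "a < r - d"
      using r by (simp add: d_def field_simps)
    ultimately show ?case
      by simp
  qed
next
  fix a :: real
  assume a: "sqrt 3 / 8 < a"
  have "sqrt 3 < 2"
    by (rule real_less_lsqrt) auto
  \<comment> \<open>The cap \<open>1/4\<close> meets the range condition of
    \<open>median_abs_dev_le\<close>; there is room below it because
    \<open>sqrt 3 < 2\<close>.\<close>
  with a obtain r where r: "sqrt 3 / 8 < r" "r < min a (1 / 4)"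
    using dense[of "sqrt 3 / 8" "min a (1 / 4)"] by auto
  have "0 < sqrt (3::real)"
    by simp
  with r have "0 \<le> r"
    by linarith
  define d where "d = (a - r) / 2"
  have "d > 0"
    using r by (simp add: d_def)
  have "1 / 2 < gap r"
    using gap_strict_mono[OF r(1)] gap_sqrt3 by simp
  then have "\<forall>\<^sub>F n in sequentially. 2 < (2 * gap r - 1) * real n"
    by (intro eventually_less_linear) simp
  with eventually_median_first_squares_near[OF \<open>d > 0\<close>] eventually_gt_at_top[of 0]
  show "\<forall>\<^sub>F n in sequentially. median_abs_dev (mset_set (first_squares n)) / (real n)\<^sup>2 < a"
  proof eventually_elim
    case (elim n)
    have "median_abs_dev (mset_set (first_squares n)) \<le> (r + d) * (real n)\<^sup>2"
      using elim r \<open>0 \<le> r\<close> by (intro median_abs_dev_le) (auto simp: algebra_simps)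
    then have "median_abs_dev (mset_set (first_squares n)) / (real n)\<^sup>2 \<le> r + d"
      using elim by (simp add: pos_divide_le_eq)
    moreover have "r + d < a"
      using r by (simp add: d_def field_simps)
    ultimately show ?case
      by simp
  qed
qed

end
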